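(* Let $\mathcal I$ be a marriage instance with the same number of men and women in which every man-woman pair is acceptable, let $A,b$ be induced by $\mathcal I$, and let $C$ be an ordinal matrix consistent with $\mathcal I$. Then every dominating vertex of $(A,b,C)$ is the characteristic vector of a stable matching $\mu$ of $\mathcal I$ that is $v$-optimal for some agent $v$.
   Context: A marriage instance on agents $V=\{v_1,\dots,v_n\}=M\cup W$ is given by a bipartite graph $G$ whose valid edges $e_{n+1},\dots,e_{n+m}$ join men and women, plus one loop $e_i$ at each $v_i$, and strict preferences $\succ_v$ for each agent $v$ over the edges containing $v$, with $v$'s loop last. A matching is a set $\mu$ of edges such that each agent lies in exactly one edge of $\mu$ (a loop meaning unmatched); it is stable if no valid edge $(m,w)\notin\mu$ is preferred by both $m$ and $w$ to their edges in $\mu$. $\mu$ is $v$-optimal if $v$'s partner in $\mu$ is $v$'s most preferred partner among all partners $v$ has across all stable matchings. Induced $A,b$: $A=(I\mid A')\in\{0,1\}^{n\times(n+m)}$, column $j$ corresponds to $e_j$, $I$ the identity (loops), $A'$ the node-edge incidence matrix of valid edges; $b=(1,\dots,1)^T$. Ordinal matrix: $C\in\mathbb Z^{n\times(n+m)}$ with pairwise distinct entries in each row and $c_{ii}<c_{ik}<c_{ij}$ for $i\ne j\in[n]$, $k\in[n+m]\setminus[n]$. Consistency: (i) if $v_i\in e_j$ and $v_{\bar\imath}\notin e_j$ then $c_{ij}<c_{\bar\imath j}$; (ii) if $v_i\in e_j,e_\ell$ then $c_{ij}>c_{i\ell}$ iff $e_j\succ_{v_i}e_\ell$. An ordinal basis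 of $C$ is a set $D$ of $n$ columns such that, with $u_i=\min_{j\in D}c_{ij}$, every column $h$ has some $i$ with $u_i\ge c_{ih}$. A dominating vertex of $(A,b,C)$ is the basic feasible solution of $\{x\ge0:Ax=b\}$ associated to a feasible basis $B$ (columns of $A$ forming a basis with $A_B^{-1}b\ge0$) that is also an ordinal basis of $C$.
   Formalization: Consistency (i) is replaced by its row-wise form: if v_i lies in e_j but not in e_l, then c_ij < c_il; with the column-wise condition as printed, some dominating vertices are unstable matchings. At least one agent is assumed. *)

theory Defs
  imports
    "Jordan_Normal_Form.DL_Submatrix"
    "Jordan_Normal_Form.Gauss_Jordan_Elimination"
    "Jordan_Normal_Form.VS_Connect"
begin

text \<open>Edges are sets of agents: the valid edge joining \<open>a\<close> and \<open>b\<close> is \<open>{a, b}\<close>, the loop at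
  \<open>a\<close> is \<open>{a}\<close>. \<open>prefers I a f g\<close> means that \<open>a\<close> strictly prefers \<open>f\<close> to \<open>g\<close>; only its
  restriction to edges containing \<open>a\<close> matters.\<close>

record 'a marriage =
  men :: "'a set"
  women :: "'a set"
  valid_edges :: "'a set set"
  prefers :: "'a \<Rightarrow> 'a set \<Rightarrow> 'a set \<Rightarrow> bool"

definition agents :: "'a marriage \<Rightarrow> 'a set" where
  "agents I = men I \<union> women I"

definition edges :: "'a marriage \<Rightarrow> 'a set set" where
  "edges I = (\<lambda>a. {a}) ` agents I \<union> valid_edges I"

definition edges_at :: "'a marriage \<Rightarrow> 'a \<Rightarrow> 'a set set" where
  "edges_at I a = {f \<in> edges I. a \<in> f}"

definition marriage_instance :: "'a marriage \<Rightarrow> bool" where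
  "marriage_instance I \<longleftrightarrow>
     finite (agents I) \<and> agents I \<noteq> {} \<and> men I \<inter> women I = {} \<and>
     valid_edges I \<subseteq> {{m, w} | m w. m \<in> men I \<and> w \<in> women I} \<and>
     (\<forall>a \<in> agents I.
        irreflp_on (edges_at I a) (prefers I a) \<and>
        transp_on (edges_at I a) (prefers I a) \<and>
        totalp_on (edges_at I a) (prefers I a) \<and>
        (\<forall>f \<in> edges_at I a. f \<noteq> {a} \<longrightarrow> prefers I a f {a}))"

definition matching :: "'a marriage \<Rightarrow> 'a set set \<Rightarrow> bool" where
  "matching I \<mu> \<longleftrightarrow> \<mu> \<subseteq> edges I \<and> (\<forall>a \<in> agents I. \<exists>!f. f \<in> \<mu> \<and> a \<in> f)"

definition edge_of :: "'a set set \<Rightarrow> 'a \<Rightarrow> 'a set" where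
  "edge_of \<mu> a = (THE f. f \<in> \<mu> \<and> a \<in> f)"

definition stable_matching :: "'a marriage \<Rightarrow> 'a set set \<Rightarrow> bool" where
  "stable_matching I \<mu> \<longleftrightarrow> matching I \<mu> \<and>
     \<not> (\<exists>m \<in> men I. \<exists>w \<in> women I. {m, w} \<in> valid_edges I \<and> {m, w} \<notin> \<mu> \<and>
          prefers I m {m, w} (edge_of \<mu> m) \<and> prefers I w {m, w} (edge_of \<mu> w))"

text \<open>An unmatched agent is its own partner, since \<open>{a, a} = {a}\<close>.\<close>

definition partner :: "'a set set \<Rightarrow> 'a \<Rightarrow> 'a" where
  "partner \<mu> a = (THE p. {a, p} \<in> \<mu>)"

definition optimal_for :: "'a marriage \<Rightarrow> 'a \<Rightarrow> 'a set set \<Rightarrow> bool" where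
  "optimal_for I a \<mu> \<longleftrightarrow>
     (\<forall>p \<in> {partner \<nu> a | \<nu>. stable_matching I \<nu>}.
        p \<noteq> partner \<mu> a \<longrightarrow> prefers I a {a, partner \<mu> a} {a, p})"

text \<open>Agents, edges, rows and columns are numbered from 0: with \<open>n\<close> agents and \<open>m\<close> valid edges,
  indices below \<open>n\<close> are agents and their loops, indices \<open>n, \<dots>, n + m - 1\<close> are valid edges.\<close>

definition enumeration :: "'a marriage \<Rightarrow> (nat \<Rightarrow> 'a) \<Rightarrow> (nat \<Rightarrow> 'a set) \<Rightarrow> bool" where
  "enumeration I v e \<longleftrightarrow>
     (let n = card (agents I); m = card (valid_edges I) in
        bij_betw v {..<n} (agents I) \<and>
        (\<forall>i<n. e i = {v i}) \<and>
        bij_betw e {n..<n + m} (valid_edges I))"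

definition induced_A :: "'a marriage \<Rightarrow> (nat \<Rightarrow> 'a) \<Rightarrow> (nat \<Rightarrow> 'a set) \<Rightarrow> real mat" where
  "induced_A I v e =
     (let n = card (agents I); m = card (valid_edges I) in
        mat n (n + m) (\<lambda>(i, j). of_bool (if j < n then i = j else v i \<in> e j)))"

definition induced_b :: "'a marriage \<Rightarrow> real vec" where
  "induced_b I = vec (card (agents I)) (\<lambda>_. 1)"

definition characteristic_vec ::
    "'a marriage \<Rightarrow> (nat \<Rightarrow> 'a set) \<Rightarrow> 'a set set \<Rightarrow> real vec" where
  "characteristic_vec I e \<mu> =
     vec (card (agents I) + card (valid_edges I)) (\<lambda>j. of_bool (e j \<in> \<mu>))"

definition ordinal_matrix :: "nat \<Rightarrow> nat \<Rightarrow> int mat \<Rightarrow> bool" where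
  "ordinal_matrix n m C \<longleftrightarrow> C \<in> carrier_mat n (n + m) \<and>
     (\<forall>i<n. inj_on (\<lambda>j. C $$ (i, j)) {..<n + m}) \<and>
     (\<forall>i<n. \<forall>j<n. \<forall>k \<in> {n..<n + m}. i \<noteq> j \<longrightarrow>
        C $$ (i, i) < C $$ (i, k) \<and> C $$ (i, k) < C $$ (i, j))"

text \<open>The first condition compares entries of one row, as is usual for Scarf's lemma: an agent's
  own edges come before the edges not containing the agent. Comparing instead, within a column,
  the rows of agents on the edge with the other rows would not do: domination depends only on
  the order inside each row, and dominating vertices could then be unstable matchings.\<close>

definition consistent ::
    "'a marriage \<Rightarrow> (nat \<Rightarrow> 'a) \<Rightarrow> (nat \<Rightarrow> 'a set) \<Rightarrow> int mat \<Rightarrow> bool" where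
  "consistent I v e C \<longleftrightarrow>
     (let n = card (agents I); m = card (valid_edges I) in
       (\<forall>i<n. \<forall>j<n + m. \<forall>l<n + m. v i \<in> e j \<and> v i \<notin> e l \<longrightarrow> C $$ (i, j) < C $$ (i, l)) \<and>
       (\<forall>i<n. \<forall>j<n + m. \<forall>l<n + m. v i \<in> e j \<and> v i \<in> e l \<longrightarrow>
          (C $$ (i, j) > C $$ (i, l) \<longleftrightarrow> prefers I (v i) (e j) (e l))))"

definition ordinal_basis :: "int mat \<Rightarrow> nat set \<Rightarrow> bool" where
  "ordinal_basis C D \<longleftrightarrow> D \<subseteq> {..<dim_col C} \<and> card D = dim_row C \<and>
     (\<forall>h<dim_col C. \<exists>i<dim_row C. Min ((\<lambda>j. C $$ (i, j)) ` D) \<ge> C $$ (i, h))"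

text \<open>\<open>A\<^sub>B\<^sup>-\<^sup>1 b\<close>, where the columns of \<open>A\<^sub>B\<close> are those of \<open>A\<close> indexed by \<open>B\<close>, in increasing order.\<close>

definition basic_part :: "real mat \<Rightarrow> real vec \<Rightarrow> nat set \<Rightarrow> real vec" where
  "basic_part A b B = the (mat_inverse (submatrix A UNIV B)) *\<^sub>v b"

definition feasible_basis :: "real mat \<Rightarrow> real vec \<Rightarrow> nat set \<Rightarrow> bool" where
  "feasible_basis A b B \<longleftrightarrow> B \<subseteq> {..<dim_col A} \<and> card B = dim_row A \<and>
     vectorspace.basis class_ring (module_vec TYPE(real) (dim_row A)) (col A ` B) \<and>
     0\<^sub>v (dim_row A) \<le> basic_part A b B"

text \<open>Column \<open>j \<in> B\<close> of \<open>A\<close> is column number \<open>card {k \<in> B. k < j}\<close> of \<open>A\<^sub>B\<close>.\<close>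

definition basic_solution :: "real mat \<Rightarrow> real vec \<Rightarrow> nat set \<Rightarrow> real vec" where
  "basic_solution A b B = vec (dim_col A)
     (\<lambda>j. if j \<in> B then basic_part A b B $ card {k \<in> B. k < j} else 0)"

definition dominating_vertex :: "real mat \<Rightarrow> real vec \<Rightarrow> int mat \<Rightarrow> real vec \<Rightarrow> bool" where
  "dominating_vertex A b C x \<longleftrightarrow>
     (\<exists>B. feasible_basis A b B \<and> ordinal_basis C B \<and> x = basic_solution A b B)"

end

theory Submission
  imports Defs "Jordan_Normal_Form.DL_Rank"
begin

text \<open>Domination says that every edge has an endpoint that likes all its basis edges at least as
  much. Together with independence of the basis columns this forces the basic solution to be
  integral, hence a stable matching \<open>\<mu>\<close>. The basis contains the loop of some agent \<open>p\<close>, because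
  valid edges alone do not span. That loop is worse for \<open>p\<close> than any valid edge, so every edge at
  \<open>p\<close> is dominated at its other endpoint: no agent on the opposite side prefers \<open>p\<close> to its partner
  in \<open>\<mu>\<close>. Hence \<open>p\<close> cannot do worse than \<open>\<mu>\<close> in a stable matching, and since partners have
  opposite interests, \<open>\<mu>\<close> is optimal for the partner of \<open>p\<close>.\<close>

section \<open>Feasible bases\<close>

text \<open>Counting the smaller elements of \<open>B\<close> inverts \<open>pick B\<close>. This
  turns sums over column positions of the submatrix into sums over \<open>B\<close> itself.\<close>

lemma bij_betw_pick:
  assumes "finite B"
  shows "bij_betw (pick B) {..<card B} B"
proof (rule bij_betw_byWitness[where f' = "\<lambda>j. card {k \<in> B. k < j}"])
  show "\<forall>i\<in>{..<card B}. card {k \<in> B. k < pick B i} = i"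
    by (simp add: card_pick_le)
  show "\<forall>j\<in>B. pick B (card {k \<in> B. k < j}) = j"
    by (simp add: pick_card_in_set)
  show "pick B ` {..<card B} \<subseteq> B"
    by (auto intro: pick_in_set_le)
  show "(\<lambda>j. card {k \<in> B. k < j}) ` B \<subseteq> {..<card B}"
    using assms by (auto intro!: psubset_card_mono)
qed

text \<open>The basis hypothesis concerns a set of vectors, in which repeated columns would
  collapse. Since the space has dimension \<open>n = card B\<close>, no two indices in
  \<open>B\<close> share a column, so the submatrix has \<open>n\<close> distinct independent
  columns and full rank.\<close>

lemma det_nonzero_if_columns_basis:
  fixes A :: "real mat"
  assumes A: "A \<in> carrier_mat n N" and B: "B \<subseteq> {..<N}" "card B = n"
    and basis: "vectorspace.basis class_ring (module_vec TYPE(real) n) (col A ` B)"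
  shows "submatrix A UNIV B \<in> carrier_mat n n" "det (submatrix A UNIV B) \<noteq> 0"
proof -
  interpret vec_space "TYPE(real)" n .
  let ?S = "submatrix A UNIV B"
  have fin: "finite B" using B(1) finite_subset by blast
  have Bc: "{j. j < N \<and> j \<in> B} = B" using B(1) by auto
  show S: "?S \<in> carrier_mat n n"
    using A B(2) by (intro carrier_matI) (simp_all add: dim_submatrix Bc)
  have colS: "col ?S j = col A (pick B j)" if "j < n" for j
  proof (rule eq_vecI)
    have p: "pick B j < N"
      using pick_in_set_le[of j B] that B by auto
    show "dim_vec (col ?S j) = dim_vec (col A (pick B j))" using S A by simp
    fix i assume "i < dim_vec (col A (pick B j))"
    then have i: "i < n" using A by simp
    then show "col ?S j $ i = col A (pick B j) $ i"
      using S A that p B(2) by (simp add: submatrix_index Bc pick_UNIV)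
  qed
  have cols: "cols ?S = map (\<lambda>j. col A (pick B j)) [0..<n]"
    using S colS by (simp add: cols_def)
  have pick: "bij_betw (pick B) {..<n} B" using bij_betw_pick[OF fin] B(2) by simp
  have "dim = card (col A ` B)" using dim_basis[OF _ basis] fin by simp
  then have "inj_on (col A) B" using B(2) fin dim_is_n by (simp add: eq_card_imp_inj_on)
  then have inj: "inj_on (\<lambda>j. col A (pick B j)) {..<n}"
    using pick comp_inj_on[of "pick B" "{..<n}" "col A"] by (simp add: bij_betw_def comp_def)
  have "distinct (cols ?S)"
    using inj unfolding cols by (simp add: distinct_map atLeast0LessThan)
  moreover have "set (cols ?S) = col A ` B"
    using pick unfolding cols by (simp add: bij_betw_def image_image[symmetric] atLeast0LessThan)
  moreover have "lin_indpt (col A ` B)" using basis by (simp add: basis_def)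
  ultimately have "rank ?S = n" using lin_indpt_full_rank[OF S] by simp
  then show "det ?S \<noteq> 0" using det_rank_iff[OF S] by simp
qed

context
  fixes A :: "real mat" and b :: "real vec" and B :: "nat set" and n N :: nat
  assumes A: "A \<in> carrier_mat n N" and b: "b \<in> carrier_vec n"
    and feasible: "feasible_basis A b B"
begin

lemma feasible_basis_subset: "B \<subseteq> {..<N}" "card B = n" "finite B"
  using A feasible finite_subset[of B "{..<N}"] by (auto simp: feasible_basis_def)

lemma feasible_basis_submatrix:
  "submatrix A UNIV B \<in> carrier_mat n n" "det (submatrix A UNIV B) \<noteq> 0"
  using det_nonzero_if_columns_basis[OF A feasible_basis_subset(1,2)] A feasible
  by (auto simp: feasible_basis_def)

lemma feasible_basis_submatrix_index:
  assumes "i < n" "k < n"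
  shows "submatrix A UNIV B $$ (i, k) = A $$ (i, pick B k)"
proof -
  have "{j. j < dim_col A \<and> j \<in> B} = B" using A feasible_basis_subset by auto
  then show ?thesis
    using assms A feasible_basis_subset(2) by (simp add: submatrix_index pick_UNIV)
qed

text \<open>After this reindexing, the order of the columns inside the submatrix no longer
  matters.\<close>

lemma submatrix_mult_vec_index:
  assumes "i < n"
  shows "(submatrix A UNIV B *\<^sub>v vec n (\<lambda>k. g (pick B k))) $ i = (\<Sum>j\<in>B. A $$ (i, j) * g j)"
proof -
  let ?S = "submatrix A UNIV B"
  have "(?S *\<^sub>v vec n (\<lambda>k. g (pick B k))) $ i = (\<Sum>k<n. ?S $$ (i, k) * g (pick B k))"
    using assms feasible_basis_submatrix(1)
    by (auto simp: scalar_prod_def atLeast0LessThan intro!: sum.cong)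
  also have "\<dots> = (\<Sum>k<n. A $$ (i, pick B k) * g (pick B k))"
    using assms by (simp add: feasible_basis_submatrix_index)
  also have "\<dots> = (\<Sum>j\<in>B. A $$ (i, j) * g j)"
    using sum.reindex_bij_betw[OF bij_betw_pick[OF feasible_basis_subset(3)],
        of "\<lambda>j. A $$ (i, j) * g j"] by (simp add: feasible_basis_subset(2))
  finally show ?thesis .
qed

text \<open>Independence of the basis columns, phrased for weights on \<open>B\<close>. It later
  shows that no nontrivial signed combination of basis edges cancels at every agent.\<close>

lemma feasible_basis_kernel:
  assumes "\<And>i. i < n \<Longrightarrow> (\<Sum>j\<in>B. A $$ (i, j) * g j) = 0" and "j \<in> B"
  shows "g j = 0"
proof -
  let ?S = "submatrix A UNIV B" and ?y = "vec n (\<lambda>k. g (pick B k))"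
  have "?S *\<^sub>v ?y = 0\<^sub>v n"
    using feasible_basis_submatrix(1) submatrix_mult_vec_index assms(1) by (intro eq_vecI) auto
  then have "?y = 0\<^sub>v n"
    using det_0_iff_vec_prod_zero_field[OF feasible_basis_submatrix(1)]
      feasible_basis_submatrix(2) vec_carrier by blast
  moreover obtain k where "k < n" "pick B k = j"
    using bij_betw_pick[OF feasible_basis_subset(3)] feasible_basis_subset(2) assms(2)
    by (metis bij_betw_iff_bijections lessThan_iff)
  ultimately show ?thesis
    by (metis index_vec index_zero_vec(1))
qed

text \<open>The transpose is invertible too, so no nonzero vector is orthogonal to all basis
  columns. This detects a basis without loops.\<close>

lemma feasible_basis_left_kernel:
  assumes "\<And>j. j \<in> B \<Longrightarrow> (\<Sum>i<n. A $$ (i, j) * z i) = 0" and "i < n"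
  shows "z i = 0"
proof -
  let ?T = "transpose_mat (submatrix A UNIV B)" and ?z = "vec n z"
  have T: "?T \<in> carrier_mat n n" "det ?T \<noteq> 0"
    using feasible_basis_submatrix by (auto simp: det_transpose)
  have "(?T *\<^sub>v ?z) $ k = 0" if k: "k < n" for k
  proof -
    have "(?T *\<^sub>v ?z) $ k = (\<Sum>i<n. submatrix A UNIV B $$ (i, k) * z i)"
      using k feasible_basis_submatrix(1)
      by (auto simp: scalar_prod_def atLeast0LessThan intro!: sum.cong)
    also have "\<dots> = (\<Sum>i<n. A $$ (i, pick B k) * z i)"
      using k by (simp add: feasible_basis_submatrix_index)
    also have "\<dots> = 0"
      using assms(1) pick_in_set_le[of k B] k feasible_basis_subset(2) by simp
    finally show ?thesis .
  qed
  then have "?T *\<^sub>v ?z = 0\<^sub>v n" using T by (intro eq_vecI) auto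
  then have "?z = 0\<^sub>v n" using det_0_iff_vec_prod_zero_field[OF T(1)] T(2) vec_carrier by blast
  then show ?thesis using assms(2) by (metis index_vec index_zero_vec(1))
qed

lemma basic_solution_feasible:
  defines "x \<equiv> basic_solution A b B"
  shows "dim_vec x = N" and "\<And>j. j \<in> B \<Longrightarrow> x $ j \<ge> 0"
    and "\<And>j. j < N \<Longrightarrow> j \<notin> B \<Longrightarrow> x $ j = 0"
    and "\<And>i. i < n \<Longrightarrow> (\<Sum>j\<in>B. A $$ (i, j) * x $ j) = b $ i"
proof -
  let ?S = "submatrix A UNIV B" and ?y = "basic_part A b B"
  show "dim_vec x = N" using A by (simp add: x_def basic_solution_def)
  show "x $ j = 0" if "j < N" "j \<notin> B" for j
    using A that by (simp add: x_def basic_solution_def)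
  \<comment> \<open>\<open>basic_part\<close> applies \<open>the\<close> to
    \<open>mat_inverse\<close>; the nonzero determinant guarantees that there is an inverse to
    extract.\<close>
  have "?S \<in> Units (ring_mat TYPE(real) n ())"
    by (rule det_non_zero_imp_unit[OF feasible_basis_submatrix])
  then obtain R where R: "mat_inverse ?S = Some R"
    using mat_inverse(1)[OF feasible_basis_submatrix(1), where b = "()"]
    by (cases "mat_inverse ?S") auto
  have R': "?S * R = 1\<^sub>m n" "R \<in> carrier_mat n n"
    using mat_inverse(2)[OF feasible_basis_submatrix(1) R] by auto
  have y: "?y = R *\<^sub>v b" by (simp add: basic_part_def R)
  have yc: "?y \<in> carrier_vec n" using R'(2) b by (simp add: y)
  have Sy: "?S *\<^sub>v ?y = b"
    using R' b feasible_basis_submatrix(1) unfolding y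
    by (subst assoc_mult_mat_vec[symmetric]) auto
  have pos: "0\<^sub>v n \<le> ?y" using A feasible by (auto simp: feasible_basis_def)
  have xj: "x $ j = ?y $ card {k \<in> B. k < j}" if "j \<in> B" for j
    using that feasible_basis_subset(1) A by (auto simp: x_def basic_solution_def)
  show "x $ j \<ge> 0" if j: "j \<in> B" for j
  proof -
    have "card {k \<in> B. k < j} < n"
      using feasible_basis_subset(2,3) j by (auto intro!: psubset_card_mono)
    then show ?thesis using pos yc xj[OF j] by (auto simp: less_eq_vec_def)
  qed
  \<comment> \<open>Coordinate \<open>k\<close> of the basic part is stored at index
    \<open>pick B k\<close>, below which \<open>B\<close> has exactly \<open>k\<close>
    elements.\<close>
  have "?y = vec n (\<lambda>k. x $ pick B k)"
    using yc xj pick_in_set_le[of _ B] card_pick_le[of _ B] feasible_basis_subset(2)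
    by (intro eq_vecI) auto
  then show "(\<Sum>j\<in>B. A $$ (i, j) * x $ j) = b $ i" if "i < n" for i
    using submatrix_mult_vec_index[OF that, of "\<lambda>j. x $ j"] Sy by metis
qed

end

section \<open>Integrality of dominating solutions\<close>

lemma edge_cases:
  assumes "marriage_instance I" "f \<in> edges I"
  obtains (loop) a where "a \<in> agents I" "f = {a}"
  | (pair) m w where "m \<in> men I" "w \<in> women I" "f = {m, w}"
proof -
  have "valid_edges I \<subseteq> {{m, w} | m w. m \<in> men I \<and> w \<in> women I}"
    using assms(1) by (simp add: marriage_instance_def)
  then show thesis using assms(2) loop pair unfolding edges_def by blast
qed

lemma edge_subset_agents:
  assumes "marriage_instance I" "f \<in> edges I"
  shows "f \<subseteq> agents I" "f \<noteq> {}"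
  using edge_cases[OF assms] by (auto simp: agents_def)

lemma finite_edges:
  assumes "marriage_instance I"
  shows "finite (edges I)"
proof (rule finite_subset)
  show "edges I \<subseteq> Pow (agents I)" using edge_subset_agents[OF assms] by blast
  show "finite (Pow (agents I))" using assms by (simp add: marriage_instance_def)
qed

lemma prefers_asym:
  assumes "marriage_instance I" "f \<in> edges I" "g \<in> edges I" "a \<in> f" "a \<in> g"
    "prefers I a f g"
  shows "\<not> prefers I a g f" "f \<noteq> g"
proof -
  have "a \<in> agents I" using edge_subset_agents[OF assms(1,2)] assms(4) by blast
  then have "irreflp_on (edges_at I a) (prefers I a)" "transp_on (edges_at I a) (prefers I a)"
    using assms(1) by (auto simp: marriage_instance_def)
  moreover have "f \<in> edges_at I a" "g \<in> edges_at I a" using assms by (auto simp: edges_at_def)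
  ultimately show "\<not> prefers I a g f" "f \<noteq> g"
    using assms(6) by (metis irreflp_onD transp_onD)+
qed

lemma prefers_total:
  assumes "marriage_instance I" "f \<in> edges I" "g \<in> edges I" "a \<in> f" "a \<in> g" "f \<noteq> g"
  shows "prefers I a f g \<or> prefers I a g f"
proof -
  have "a \<in> agents I" using edge_subset_agents[OF assms(1,2)] assms(4) by blast
  then have "totalp_on (edges_at I a) (prefers I a)"
    using assms(1) by (auto simp: marriage_instance_def)
  moreover have "f \<in> edges_at I a" "g \<in> edges_at I a" using assms by (auto simp: edges_at_def)
  ultimately show ?thesis using assms(6) by (metis totalp_onD)
qed

lemma edge_of_in:
  assumes "matching I \<mu>" "a \<in> agents I"
  shows "edge_of \<mu> a \<in> \<mu>" "a \<in> edge_of \<mu> a"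
  using theI'[of "\<lambda>f. f \<in> \<mu> \<and> a \<in> f"] assms by (auto simp: matching_def edge_of_def)

lemma edge_of_eq:
  assumes "matching I \<mu>" "a \<in> agents I" "f \<in> \<mu>" "a \<in> f"
  shows "edge_of \<mu> a = f"
  using assms edge_of_in[OF assms(1,2)] by (auto simp: matching_def)

lemma double_count:
  assumes "finite G" "\<Union> G \<subseteq> U" "finite U"
  shows "(\<Sum>a\<in>U. card {f \<in> G. a \<in> f}) = (\<Sum>f\<in>G. card f)"
proof -
  have "(\<Sum>a\<in>U. card {f \<in> G. a \<in> f}) = (\<Sum>a\<in>U. \<Sum>f\<in>G. if a \<in> f then 1 else 0)"
    using assms by (intro sum.cong) (auto simp: sum.If_cases Int_def)
  also have "\<dots> = (\<Sum>f\<in>G. \<Sum>a\<in>U. if a \<in> f then 1 else 0)" by (rule sum.swap)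
  also have "\<dots> = (\<Sum>f\<in>G. card f)"
  proof (intro sum.cong refl)
    fix f assume "f \<in> G"
    then have "U \<inter> f = f" using assms by blast
    then show "(\<Sum>a\<in>U. if a \<in> f then 1 else 0) = card f"
      using assms by (simp add: sum.If_cases)
  qed
  finally show ?thesis .
qed

text \<open>A matrix-free form of a dominating vertex: \<open>F\<close> consists of the basis edges
  and \<open>X\<close> of their values. \<open>nonneg\<close> and \<open>total\<close> express
  feasibility, \<open>kernel\<close> the independence of the columns, and \<open>dominating\<close>
  the ordinal basis property.\<close>

locale dominating_solution =
  fixes I :: "'a marriage" and F :: "'a set set" and X :: "'a set \<Rightarrow> real"
  assumes inst: "marriage_instance I"
    and sub: "F \<subseteq> edges I"
    and nonneg: "f \<in> F \<Longrightarrow> X f \<ge> 0"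
    and total: "a \<in> agents I \<Longrightarrow> (\<Sum>f\<in>{f \<in> F. a \<in> f}. X f) = 1"
    and kernel: "(\<And>a. a \<in> agents I \<Longrightarrow> (\<Sum>f\<in>{f \<in> F. a \<in> f}. g f) = (0 :: real)) \<Longrightarrow>
      f \<in> F \<Longrightarrow> g f = 0"
    and dominating: "h \<in> edges I \<Longrightarrow> \<exists>a\<in>h. \<forall>f\<in>F. a \<in> f \<longrightarrow> f = h \<or> prefers I a f h"
begin

lemma finite_F: "finite F"
  using finite_subset[OF sub finite_edges[OF inst]] .

definition fractional :: "'a set set" where
  "fractional = {f \<in> F. X f \<noteq> 0 \<and> X f \<noteq> 1}"

text \<open>Both endpoints of an edge may dominate it; fixing one makes edges countable by their
  dominating endpoints.\<close>

definition dominator :: "'a set \<Rightarrow> 'a" where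
  "dominator h = (SOME a. a \<in> h \<and> (\<forall>f\<in>F. a \<in> f \<longrightarrow> f = h \<or> prefers I a f h))"

lemma dominator:
  assumes "h \<in> edges I"
  shows "dominator h \<in> h" "\<And>f. f \<in> F \<Longrightarrow> dominator h \<in> f \<Longrightarrow> f = h \<or> prefers I (dominator h) f h"
proof -
  have "\<exists>a. a \<in> h \<and> (\<forall>f\<in>F. a \<in> f \<longrightarrow> f = h \<or> prefers I a f h)"
    using dominating[OF assms] by blast
  from someI_ex[OF this] show "dominator h \<in> h"
    "\<And>f. f \<in> F \<Longrightarrow> dominator h \<in> f \<Longrightarrow> f = h \<or> prefers I (dominator h) f h"
    unfolding dominator_def by blast+
qed

text \<open>If two distinct edges of \<open>F\<close> were dominated at the same agent, both would
  contain that agent, which would then prefer each of them to the other.\<close>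

lemma inj_on_dominator: "inj_on dominator F"
proof (rule inj_onI, rule ccontr)
  fix f g assume fg: "f \<in> F" "g \<in> F" "dominator f = dominator g" "f \<noteq> g"
  have "f \<in> edges I" "g \<in> edges I" using fg sub by auto
  note d = dominator[OF this(1)] dominator[OF this(2)]
  have "prefers I (dominator f) g f" "prefers I (dominator f) f g"
    using d fg by metis+
  then show False
    using prefers_asym[OF inst \<open>f \<in> edges I\<close> \<open>g \<in> edges I\<close>] d fg(3) by metis
qed

lemma fractional_degree:
  assumes "a \<in> \<Union> fractional"
  shows "2 \<le> card {f \<in> fractional. a \<in> f}"
proof -
  obtain f where f: "f \<in> F" "a \<in> f" "X f \<noteq> 0" "X f \<noteq> 1"
    using assms by (auto simp: fractional_def)
  have a: "a \<in> agents I" using edge_subset_agents[OF inst] sub f by blast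
  let ?R = "{g \<in> F. a \<in> g} - {f}"
  have fin: "finite ?R" using finite_F by simp
  have sum: "X f + (\<Sum>g\<in>?R. X g) = 1"
    using total[OF a] sum.remove[of "{g \<in> F. a \<in> g}" f X] f finite_F by simp
  then have "(\<Sum>g\<in>?R. X g) \<noteq> 0" using f by simp
  then obtain g where g: "g \<in> ?R" "X g \<noteq> 0"
    by (rule sum.not_neutral_contains_not_neutral)
  \<comment> \<open>The other edges at \<open>a\<close> carry total value \<open>1 - X f\<close>,
    which is below 1 because \<open>X f\<close> is positive; hence \<open>g\<close> is fractional as
    well.\<close>
  have "X g \<le> (\<Sum>g\<in>?R. X g)"
    using g(1) nonneg fin by (intro member_le_sum) auto
  then have "X g < 1" using sum nonneg[OF f(1)] f(3) by simp
  then have "{f, g} \<subseteq> {f \<in> fractional. a \<in> f}" "f \<noteq> g"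
    using f g by (auto simp: fractional_def)
  then show ?thesis
    using card_mono[of "{f \<in> fractional. a \<in> f}" "{f, g}"] finite_F
    by (simp add: fractional_def)
qed

lemma card_edge_le: "f \<in> edges I \<Longrightarrow> card f \<le> 2"
  by (cases rule: edge_cases[OF inst]) (auto simp: card_insert_if)

text \<open>Each agent on a fractional edge lies on at least two of them, while sending an edge to its
  dominating endpoint is injective. Double counting makes both estimates sharp, so the fractional
  edges form disjoint cycles, around which the side of the dominating endpoint alternates.\<close>

lemma fractional_empty: "fractional = {}"
proof (rule ccontr)
  assume ne: "fractional \<noteq> {}"
  define S where "S = \<Union> fractional"
  have subF: "fractional \<subseteq> F" by (auto simp: fractional_def)
  then have subE: "fractional \<subseteq> edges I" using sub by blast
  have fin: "finite fractional" using subF finite_F finite_subset by blast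
  have SA: "S \<subseteq> agents I" using edge_subset_agents[OF inst] subE by (auto simp: S_def)
  have finS: "finite S" using SA inst finite_subset by (auto simp: marriage_instance_def)
  have dS: "dominator ` fractional \<subseteq> S"
    using dominator(1) subE by (auto simp: S_def)
  have inj: "inj_on dominator fractional" using inj_on_dominator subF inj_on_subset by blast
  have le: "card fractional \<le> card S" using card_inj_on_le[OF inj dS finS] .
  have deg: "2 \<le> card {f \<in> fractional. a \<in> f}" if "a \<in> S" for a
    using fractional_degree that by (simp add: S_def)
  have dc: "(\<Sum>a\<in>S. card {f \<in> fractional. a \<in> f}) = (\<Sum>f\<in>fractional. card f)"
    by (rule double_count[OF fin _ finS]) (simp add: S_def)
  have up: "(\<Sum>f\<in>fractional. card f) \<le> (\<Sum>f\<in>fractional. 2)"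
    using card_edge_le subE by (intro sum_mono) auto
  have lo: "(\<Sum>a\<in>S. 2) \<le> (\<Sum>a\<in>S. card {f \<in> fractional. a \<in> f})"
    using deg by (intro sum_mono) auto
  \<comment> \<open>With \<open>s = card S\<close> and \<open>k = card fractional\<close>, the
    bounds chain to \<open>2 * s <= 2 * k <= 2 * s\<close>, so every inequality used is an
    equality.\<close>
  have eq: "card fractional = card S" using le up lo dc by simp
  have edge2: "card f = 2" if "f \<in> fractional" for f
  proof -
    have "(\<Sum>f\<in>fractional. card f) = (\<Sum>f\<in>fractional. 2)" using up lo dc eq by simp
    then show ?thesis
      using sum_mono_inv[of card fractional "\<lambda>_. 2" f] card_edge_le subE fin that by auto
  qed
  have deg2: "card {f \<in> fractional. a \<in> f} = 2" if "a \<in> S" for a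
  proof -
    have "(\<Sum>a\<in>S. 2) = (\<Sum>a\<in>S. card {f \<in> fractional. a \<in> f})" using up lo dc eq by simp
    then show ?thesis
      using sum_mono_inv[of "\<lambda>_. 2" S "\<lambda>a. card {f \<in> fractional. a \<in> f}" a] deg finS that
      by auto
  qed
  have surj: "dominator ` fractional = S"
    using card_subset_eq[OF finS dS] card_image[OF inj] eq by simp
  \<comment> \<open>Each fractional edge is signed by the side of its dominating endpoint. These
    signs cancel at every agent, which contradicts \<open>kernel\<close>.\<close>
  define g where "g f = (if f \<in> fractional then if dominator f \<in> men I then 1 else -1 else 0 :: real)"
    for f
  have "(\<Sum>f\<in>{f \<in> F. a \<in> f}. g f) = 0" if a: "a \<in> agents I" for a
  proof -
    have "(\<Sum>f\<in>{f \<in> F. a \<in> f}. g f) = (\<Sum>f\<in>{f \<in> fractional. a \<in> f}. g f)"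
      using subF finite_F by (intro sum.mono_neutral_right) (auto simp: g_def)
    also have "\<dots> = 0"
    proof (cases "a \<in> S")
      case False
      then have "{f \<in> fractional. a \<in> f} = {}" by (auto simp: S_def)
      then show ?thesis by (simp only: sum.empty)
    next
      case True
      \<comment> \<open>Surjectivity gives a fractional edge \<open>f\<close> dominated at
        \<open>a\<close>. By injectivity the second fractional edge \<open>h\<close> at
        \<open>a\<close> is dominated at its other endpoint, on the opposite side, so the two signs
        are opposite.\<close>
      then obtain f where f: "f \<in> fractional" "dominator f = a" using surj by blast
      have af: "a \<in> f" using dominator(1)[of f] f subE by auto
      obtain f1 f2 where "{f \<in> fractional. a \<in> f} = {f1, f2}" "f1 \<noteq> f2"
        using deg2[OF True] by (meson card_2_iff)
      then obtain h where h: "{f \<in> fractional. a \<in> f} = {f, h}" "f \<noteq> h"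
        using f(1) af by (metis (mono_tags, lifting) doubleton_eq_iff insertE mem_Collect_eq singletonD)
      have hf: "h \<in> fractional" "a \<in> h" using h by auto
      have "dominator h \<noteq> a" using inj h f hf by (metis inj_onD)
      moreover have "dominator h \<in> h" using dominator(1)[of h] hf subE by auto
      moreover obtain m w where "m \<in> men I" "w \<in> women I" "h = {m, w}"
        using hf(1) subE edge2[OF hf(1)] by (cases rule: edge_cases[OF inst, of h]) auto
      moreover have "men I \<inter> women I = {}" using inst by (simp add: marriage_instance_def)
      ultimately have "dominator h \<in> men I \<longleftrightarrow> a \<notin> men I" using hf(2) by auto
      then show ?thesis using h(2) f hf(1) unfolding h(1) by (simp add: g_def)
    qed
    finally show ?thesis .
  qed
  then have "g f = 0" if "f \<in> F" for f using kernel that by blast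
  then show False using ne subF by (force simp: g_def split: if_splits)
qed

lemma value_cases: "f \<in> F \<Longrightarrow> X f = 0 \<or> X f = 1"
  using fractional_empty by (auto simp: fractional_def)

definition support :: "'a set set" where
  "support = {f \<in> F. X f = 1}"

lemma matching_support: "matching I support"
  unfolding matching_def
proof (intro conjI ballI)
  show "support \<subseteq> edges I" using sub by (auto simp: support_def)
  fix a assume a: "a \<in> agents I"
  have "(\<Sum>f\<in>{f \<in> F. a \<in> f}. X f) = (\<Sum>f\<in>{f \<in> support. a \<in> f}. 1)"
    using finite_F value_cases by (intro sum.mono_neutral_cong_right) (auto simp: support_def)
  then have "card {f \<in> support. a \<in> f} = 1" using total[OF a] by simp
  then have "\<exists>!f. f \<in> {f \<in> support. a \<in> f}" 
    by (rule card_1_singletonE) (simp only: singleton_iff, simp)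
  then show "\<exists>!f. f \<in> support \<and> a \<in> f" by simp
qed

text \<open>The support edge at the dominating endpoint belongs to \<open>F\<close>, so domination
  applies to it, and it differs from \<open>h\<close>. This also covers basis edges \<open>h\<close>
  of value 0.\<close>

lemma support_dominates:
  assumes "h \<in> edges I" "h \<notin> support"
  shows "prefers I (dominator h) (edge_of support (dominator h)) h"
proof -
  have a: "dominator h \<in> h" "dominator h \<in> agents I"
    using dominator(1) edge_subset_agents[OF inst] assms by auto
  note e = edge_of_in[OF matching_support a(2)]
  then have "edge_of support (dominator h) \<in> F" by (auto simp: support_def)
  then show ?thesis using dominator(2)[OF assms(1)] e assms(2) by metis
qed

text \<open>Both endpoints of a blocking pair prefer it to their support edges, but its dominating
  endpoint has the opposite preference.\<close>

lemma stable_support: "stable_matching I support"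
proof -
  have False if "m \<in> men I" "w \<in> women I" and h: "{m, w} \<in> valid_edges I" "{m, w} \<notin> support"
    and pref: "prefers I m {m, w} (edge_of support m)" "prefers I w {m, w} (edge_of support w)"
    for m w
  proof -
    let ?a = "dominator {m, w}"
    have E: "{m, w} \<in> edges I" using h by (simp add: edges_def)
    have a: "?a \<in> {m, w}" "?a \<in> agents I"
      using dominator(1)[OF E] edge_subset_agents[OF inst E] by auto
    then have "prefers I ?a {m, w} (edge_of support ?a)" using pref by auto
    moreover have "edge_of support ?a \<in> edges I" "?a \<in> edge_of support ?a"
      using edge_of_in[OF matching_support a(2)] sub by (auto simp: support_def)
    ultimately show False
      using prefers_asym(1)[OF inst E] a(1) support_dominates[OF E h(2)] by blast
  qed
  then show ?thesis using matching_support unfolding stable_matching_def by blast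
qed

end

section \<open>Optimality in complete markets\<close>

text \<open>\<open>P\<close> and \<open>Q\<close> stand for the two sides in either order, so that
  every fact proved for \<open>P\<close> transfers to \<open>Q\<close> through
  \<open>swap\<close>.\<close>

locale complete_market =
  fixes I :: "'a marriage" and P Q :: "'a set"
  assumes inst: "marriage_instance I"
    and sides: "P = men I \<and> Q = women I \<or> P = women I \<and> Q = men I"
    and card_eq: "card P = card Q"
    and complete: "m \<in> men I \<Longrightarrow> w \<in> women I \<Longrightarrow> {m, w} \<in> valid_edges I"
begin

lemma swap: "complete_market I Q P"
  using inst sides card_eq complete by unfold_locales auto

lemma agents_eq: "agents I = P \<union> Q" and disjoint: "P \<inter> Q = {}"
  and finite_sides: "finite P" "finite Q"
  using inst sides by (auto simp: marriage_instance_def agents_def)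

lemma valid_pair: "p \<in> P \<Longrightarrow> q \<in> Q \<Longrightarrow> {p, q} \<in> valid_edges I"
  using sides complete[of p q] complete[of q p] by (auto simp: insert_commute)

lemma pair_edge: "p \<in> P \<Longrightarrow> q \<in> Q \<Longrightarrow> {p, q} \<in> edges I"
  using valid_pair by (simp add: edges_def)

lemma edge_at_cases:
  assumes "f \<in> edges I" "p \<in> f" "p \<in> P"
  obtains "f = {p}" | q where "q \<in> Q" "f = {p, q}"
proof (cases rule: edge_cases[OF inst assms(1), case_names loop pair])
  case (loop a)
  then show thesis using that(1) assms(2) by simp
next
  case (pair m w)
  show thesis
  proof (cases "p = m")
    case True
    then have "w \<in> Q" using pair assms(3) sides disjoint by auto
    then show thesis using that(2) pair True by simp
  next
    case False
    then have "p = w" using pair assms(2) by simp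
    then have "m \<in> Q" using pair assms(3) sides disjoint by auto
    then show thesis using that(2) pair \<open>p = w\<close> by (simp add: insert_commute)
  qed
qed

lemma not_blocking:
  assumes "stable_matching I \<nu>" "p \<in> P" "q \<in> Q" "{p, q} \<notin> \<nu>"
    "prefers I p {p, q} (edge_of \<nu> p)"
  shows "\<not> prefers I q {p, q} (edge_of \<nu> q)"
proof -
  have "\<forall>m\<in>men I. \<forall>w\<in>women I. {m, w} \<in> valid_edges I \<longrightarrow> {m, w} \<notin> \<nu> \<longrightarrow>
      prefers I m {m, w} (edge_of \<nu> m) \<longrightarrow> \<not> prefers I w {m, w} (edge_of \<nu> w)"
    using assms(1) unfolding stable_matching_def by blast
  then show ?thesis
    using sides valid_pair[OF assms(2,3)] assms(2-5) by (auto simp: insert_commute)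
qed

lemma prefers_loop: "a \<in> f \<Longrightarrow> f \<in> edges I \<Longrightarrow> f \<noteq> {a} \<Longrightarrow> prefers I a f {a}"
  using inst edge_subset_agents[OF inst, of f] by (auto simp: marriage_instance_def edges_at_def)

text \<open>The sides have equal size, so an unmatched agent leaves an unmatched agent on the other
  side. The two are acceptable to each other and rank their loops last, so they would block.\<close>

lemma stable_perfect:
  assumes st: "stable_matching I \<nu>" and p: "p \<in> P"
  shows "\<exists>q\<in>Q. {p, q} \<in> \<nu>"
proof (rule ccontr)
  assume no: "\<not> ?thesis"
  have mt: "matching I \<nu>" using st by (simp add: stable_matching_def)
  have sub: "\<nu> \<subseteq> edges I" using mt by (simp add: matching_def)
  have "p \<in> agents I" using p agents_eq by simp
  note ep = edge_of_in[OF mt this]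
  have loop: "edge_of \<nu> p = {p}"
    using ep(1) sub no by (cases rule: edge_at_cases[OF _ ep(2) p]) auto
  have "\<exists>q\<in>Q. {q} \<in> \<nu>"
  proof (rule ccontr)
    assume noq: "\<not> ?thesis"
    have "\<exists>t\<in>P. {q, t} \<in> \<nu>" if q: "q \<in> Q" for q
    proof -
      have "q \<in> agents I" using q agents_eq by simp
      note eq = edge_of_in[OF mt this]
      show ?thesis
        using eq(1) sub noq q by (cases rule: complete_market.edge_at_cases[OF swap _ eq(2) q]) auto
    qed
    \<comment> \<open>If all of \<open>Q\<close> were matched, the choice of partners
      \<open>t\<close> would inject \<open>Q\<close> into \<open>P\<close> without the unmatched
      \<open>p\<close>, which is too small.\<close>
    then obtain t where t: "\<And>q. q \<in> Q \<Longrightarrow> t q \<in> P \<and> {q, t q} \<in> \<nu>" by metis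
    have uniq: "edge_of \<nu> (t q) = {q, t q}" if "q \<in> Q" for q
      using edge_of_eq[OF mt] t[OF that] agents_eq by simp
    have "inj_on t Q"
    proof (rule inj_onI)
      fix q r assume qr: "q \<in> Q" "r \<in> Q" "t q = t r"
      then have "{q, t q} = {r, t q}" using uniq by metis
      then show "q = r" by (auto simp: doubleton_eq_iff)
    qed
    moreover have "t ` Q \<subseteq> P - {p}"
    proof
      fix y assume "y \<in> t ` Q"
      then obtain q where q: "q \<in> Q" "y = t q" by blast
      have "t q \<noteq> p" using uniq[OF q(1)] loop q(1) p disjoint by auto
      then show "y \<in> P - {p}" using t q by auto
    qed
    ultimately have "card Q \<le> card (P - {p})"
      using card_inj_on_le finite_sides by blast
    then show False
      using p finite_sides card_eq by (metis card_Diff1_less not_less)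
  qed
  then obtain q where q: "q \<in> Q" "{q} \<in> \<nu>" by blast
  have "edge_of \<nu> q = {q}" using edge_of_eq[OF mt] q agents_eq by simp
  moreover have "{p, q} \<notin> \<nu>" using no q by blast
  moreover have "p \<noteq> q" using p q disjoint by auto
  ultimately show False
    using not_blocking[OF st p q(1)] prefers_loop[OF _ pair_edge[OF p q(1)]] loop
    by (metis doubleton_eq_iff insertI1 insert_absorb2 insert_commute)
qed

lemma partner_eq:
  assumes "stable_matching I \<nu>" "p \<in> P" "q \<in> Q" "{p, q} \<in> \<nu>"
  shows "partner \<nu> p = q"
  unfolding partner_def
proof (rule the_equality)
  have mt: "matching I \<nu>" using assms(1) by (simp add: stable_matching_def)
  fix r assume "{p, r} \<in> \<nu>"
  then have "{p, r} = {p, q}"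
    using edge_of_eq[OF mt, of p] assms agents_eq by (metis UnCI insertI1)
  then show "r = q" by (auto simp: doubleton_eq_iff)
qed (fact assms(4))

lemma partner:
  assumes "stable_matching I \<nu>" "p \<in> P"
  shows "partner \<nu> p \<in> Q" "{p, partner \<nu> p} \<in> \<nu>" "edge_of \<nu> p = {p, partner \<nu> p}"
    "edge_of \<nu> (partner \<nu> p) = {p, partner \<nu> p}" "partner \<nu> (partner \<nu> p) = p"
proof -
  have mt: "matching I \<nu>" using assms(1) by (simp add: stable_matching_def)
  show q: "partner \<nu> p \<in> Q" "{p, partner \<nu> p} \<in> \<nu>"
    using stable_perfect[OF assms] partner_eq[OF assms] by auto
  show "edge_of \<nu> p = {p, partner \<nu> p}" "edge_of \<nu> (partner \<nu> p) = {p, partner \<nu> p}"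
    using edge_of_eq[OF mt] q assms(2) agents_eq by auto
  show "partner \<nu> (partner \<nu> p) = p"
    using complete_market.partner_eq[OF swap assms(1) q(1) assms(2)] q(2)
    by (simp add: insert_commute)
qed

text \<open>The pair formed by \<open>p\<close> and its partner in \<open>\<mu>\<close> is absent
  from \<open>\<nu>\<close>. If the partner preferred this pair to its edge in \<open>\<nu>\<close>,
  the pair would block \<open>\<nu>\<close>; totality of preferences leaves only the
  converse.\<close>

lemma opposite_interests:
  assumes \<mu>: "stable_matching I \<mu>" and \<nu>: "stable_matching I \<nu>" and p: "p \<in> P"
    and pref: "prefers I p (edge_of \<mu> p) (edge_of \<nu> p)"
  shows "prefers I (partner \<mu> p) (edge_of \<nu> (partner \<mu> p)) (edge_of \<mu> (partner \<mu> p))"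
proof -
  let ?q = "partner \<mu> p"
  have mt: "matching I \<nu>" using \<nu> by (simp add: stable_matching_def)
  note m = partner[OF \<mu> p]
  have E: "{p, ?q} \<in> edges I" using pair_edge p m(1) by simp
  have q: "?q \<in> agents I" "p \<in> agents I" using m(1) p agents_eq by auto
  have en: "edge_of \<nu> ?q \<in> edges I" "?q \<in> edge_of \<nu> ?q"
    "edge_of \<nu> p \<in> edges I" "p \<in> edge_of \<nu> p"
    using edge_of_in[OF mt q(1)] edge_of_in[OF mt q(2)] mt by (auto simp: matching_def)
  have "edge_of \<nu> p \<noteq> {p, ?q}"
    using prefers_asym(2)[OF inst E en(3) _ en(4)] pref m(3) by simp
  then have notin: "{p, ?q} \<notin> \<nu>" using edge_of_eq[OF mt q(2)] by auto
  then have "edge_of \<nu> ?q \<noteq> {p, ?q}" using edge_of_in[OF mt q(1)] by auto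
  moreover have "\<not> prefers I ?q {p, ?q} (edge_of \<nu> ?q)"
    using not_blocking[OF \<nu> p m(1) notin] pref m(3) by simp
  ultimately show ?thesis using prefers_total[OF inst E en(1) _ en(2)] m(4) by auto
qed

lemma inj_on_partner: "stable_matching I \<nu> \<Longrightarrow> inj_on (partner \<nu>) P"
  by (rule inj_on_inverseI[of _ "partner \<nu>"]) (rule partner(5))

text \<open>By opposition of interests, \<open>\<mu>\<close> maps the agents of \<open>Q\<close> preferring \<open>\<mu>\<close> injectively into the
  agents of \<open>P\<close> preferring \<open>\<nu>\<close>, and \<open>\<nu>\<close> maps the latter injectively into the former; hence both
  maps are bijections.\<close>

lemma optimal_for_partner:
  assumes \<mu>: "stable_matching I \<mu>" and p: "p \<in> P"
    and weak: "\<And>q. q \<in> Q \<Longrightarrow> {p, q} \<notin> \<mu> \<Longrightarrow> prefers I q (edge_of \<mu> q) {p, q}"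
  shows "optimal_for I (partner \<mu> p) \<mu>"
  unfolding optimal_for_def
proof clarify
  let ?q = "partner \<mu> p"
  fix \<nu> assume \<nu>: "stable_matching I \<nu>" and ne: "partner \<nu> ?q \<noteq> partner \<mu> ?q"
  define X where "X = {q \<in> Q. prefers I q (edge_of \<mu> q) (edge_of \<nu> q)}"
  define Y where "Y = {r \<in> P. prefers I r (edge_of \<nu> r) (edge_of \<mu> r)}"
  note swapped = complete_market.partner[OF swap] complete_market.inj_on_partner[OF swap]
  have fin: "finite X" "finite Y" using finite_sides by (auto simp: X_def Y_def)
  have XY: "partner \<mu> ` X \<subseteq> Y"
    using complete_market.opposite_interests[OF swap \<mu> \<nu>] swapped(1)[OF \<mu>]
    by (auto simp: X_def Y_def)
  have YX: "partner \<nu> ` Y \<subseteq> X"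
    using opposite_interests[OF \<nu> \<mu>] partner(1)[OF \<nu>] by (auto simp: X_def Y_def)
  have inj: "inj_on (partner \<mu>) X" "inj_on (partner \<nu>) Y"
    using inj_on_subset[OF swapped(6)[OF \<mu>]] inj_on_subset[OF inj_on_partner[OF \<nu>]]
    by (auto simp: X_def Y_def)
  have "card X = card Y"
    using card_inj_on_le[OF inj(1) XY fin(2)] card_inj_on_le[OF inj(2) YX fin(1)] by simp
  then have surj: "partner \<mu> ` X = Y" "partner \<nu> ` Y = X"
    using card_subset_eq[OF fin(2) XY] card_subset_eq[OF fin(1) YX] card_image[OF inj(1)]
      card_image[OF inj(2)] by auto
  note n = partner[OF \<nu> p] and m = partner[OF \<mu> p]
  \<comment> \<open>Partners are mutual, so a change of partner for \<open>?q\<close> is also one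
    for \<open>p\<close>. The new partner of \<open>p\<close> then prefers \<open>\<mu>\<close> by
    \<open>weak\<close>, which places it in \<open>X\<close>.\<close>
  have "partner \<nu> p \<noteq> ?q" using ne m(5) n(5) by auto
  then have "{p, partner \<nu> p} \<notin> \<mu>" using partner_eq[OF \<mu> p n(1)] by auto
  then have "partner \<nu> p \<in> X" using weak[OF n(1)] n(1,4) by (simp add: X_def)
  \<comment> \<open>Surjectivity is used twice: that of \<open>\<nu>\<close> places \<open>p\<close>
    in \<open>Y\<close>, and then that of \<open>\<mu>\<close> places \<open>?q\<close> in
    \<open>X\<close>.\<close>
  then obtain r where r: "r \<in> Y" "partner \<nu> p = partner \<nu> r" using surj by blast
  then have "r = p" using inj_on_partner[OF \<nu>] p by (auto simp: Y_def dest: inj_onD)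
  then obtain q where q: "q \<in> X" "p = partner \<mu> q" using r surj by blast
  then have "q = ?q" using swapped(5)[OF \<mu>] by (auto simp: X_def)
  then have "prefers I ?q (edge_of \<mu> ?q) (edge_of \<nu> ?q)" using q by (simp add: X_def)
  then show "prefers I ?q {?q, partner \<mu> ?q} {?q, partner \<nu> ?q}"
    using swapped(3)[OF \<mu> m(1)] swapped(3)[OF \<nu> m(1)] by simp
qed

end

section \<open>Optimality of the support\<close>

context dominating_solution
begin

text \<open>The loop at \<open>p\<close> is a basis edge but not a support edge, since stable
  matchings are perfect here. It therefore has value 0 and acts only through domination, ruling out
  \<open>p\<close> as the dominating endpoint of any pair.\<close>

lemma optimal_support:
  assumes market: "complete_market I P Q" and p: "p \<in> P" "{p} \<in> F"
  shows "\<exists>a\<in>agents I. optimal_for I a support"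
proof -
  interpret complete_market I P Q by (fact market)
  have "prefers I q (edge_of support q) {p, q}" if q: "q \<in> Q" and nin: "{p, q} \<notin> support" for q
  proof -
    let ?h = "{p, q}"
    have E: "?h \<in> edges I" using pair_edge p q by simp
    have ne: "?h \<noteq> {p}" using p q disjoint by auto
    have L: "{p} \<in> edges I" using p sub by blast
    have "dominator ?h \<noteq> p"
    proof
      assume d: "dominator ?h = p"
      then have "prefers I p {p} ?h" using dominator(2)[OF E p(2)] ne by auto
      moreover have "prefers I p ?h {p}" using prefers_loop[OF _ E ne] by simp
      ultimately show False using prefers_asym(1)[OF inst L E] by simp
    qed
    then have "dominator ?h = q" using dominator(1)[OF E] by auto
    then show ?thesis using support_dominates[OF E nin] by simp
  qed
  then have "optimal_for I (partner support p) support"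
    using optimal_for_partner[OF stable_support p(1)] by blast
  moreover have "partner support p \<in> agents I"
    using partner(1)[OF stable_support p(1)] agents_eq by simp
  ultimately show ?thesis by blast
qed

end

section \<open>From matrices to edges\<close>

lemma bij_betw_enumeration:
  assumes inst: "marriage_instance I" and en: "enumeration I v e"
  shows "bij_betw e {..<card (agents I) + card (valid_edges I)} (edges I)"
proof -
  let ?n = "card (agents I)" and ?m = "card (valid_edges I)"
  have v: "bij_betw v {..<?n} (agents I)" and loops: "\<forall>i<?n. e i = {v i}"
    and valid: "bij_betw e {?n..<?n + ?m} (valid_edges I)"
    using en by (auto simp: enumeration_def Let_def)
  have "bij_betw (\<lambda>a. {a}) (agents I) ((\<lambda>a. {a}) ` agents I)"
    by (auto simp: bij_betw_def inj_on_def)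
  from bij_betw_trans[OF v this] have "bij_betw e {..<?n} ((\<lambda>a. {a}) ` agents I)"
    using loops by (subst bij_betw_cong[where g = "(\<lambda>a. {a}) \<circ> v"]) auto
  \<comment> \<open>A valid edge joins agents from disjoint sides, so it is never a
    singleton.\<close>
  moreover have "(\<lambda>a. {a}) ` agents I \<inter> valid_edges I = {}"
  proof -
    have "valid_edges I \<subseteq> {{m, w} | m w. m \<in> men I \<and> w \<in> women I}" "men I \<inter> women I = {}"
      using inst by (auto simp: marriage_instance_def)
    then have "{a} \<notin> valid_edges I" for a by (auto simp: subset_iff)
    then show ?thesis by blast
  qed
  moreover have "{..<?n} \<union> {?n..<?n + ?m} = {..<?n + ?m}" by auto
  ultimately show ?thesis
    using bij_betw_combine[OF _ valid, of "{..<?n}" "(\<lambda>a. {a}) ` agents I"]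
    by (simp add: edges_def)
qed

text \<open>The identity block is also an incidence matrix: column \<open>j\<close> there is the
  loop at \<open>v j\<close>, and \<open>v\<close> is injective. One formula thus serves both
  blocks.\<close>

lemma induced_A_index:
  assumes en: "enumeration I v e"
    and "i < card (agents I)" "j < card (agents I) + card (valid_edges I)"
  shows "induced_A I v e $$ (i, j) = of_bool (v i \<in> e j)"
proof (cases "j < card (agents I)")
  case True
  then have "v i \<in> e j \<longleftrightarrow> i = j"
    using assms by (auto simp: enumeration_def Let_def bij_betw_def dest: inj_onD)
  then show ?thesis using assms True by (simp add: induced_A_def Let_def)
next
  case False
  then show ?thesis using assms by (simp add: induced_A_def Let_def)
qed

lemma sum_edges_at:
  assumes inst: "marriage_instance I" and en: "enumeration I v e"
    and B: "B \<subseteq> {..<card (agents I) + card (valid_edges I)}" and i: "i < card (agents I)"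
  shows "(\<Sum>f\<in>{f \<in> e ` B. v i \<in> f}. g f) = (\<Sum>j\<in>B. induced_A I v e $$ (i, j) * g (e j))"
proof -
  have fin: "finite B" using B finite_subset by blast
  have inj: "inj_on e B"
    using bij_betw_enumeration[OF inst en] B by (auto simp: bij_betw_def intro: inj_on_subset)
  have "{f \<in> e ` B. v i \<in> f} = e ` {j \<in> B. v i \<in> e j}" by auto
  then have "(\<Sum>f\<in>{f \<in> e ` B. v i \<in> f}. g f) = (\<Sum>j\<in>{j \<in> B. v i \<in> e j}. g (e j))"
    using inj_on_subset[OF inj, of "{j \<in> B. v i \<in> e j}"] by (simp add: sum.reindex)
  also have "\<dots> = (\<Sum>j\<in>B. if v i \<in> e j then g (e j) else 0)"
    using fin by (simp add: sum.inter_filter)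
  also have "\<dots> = (\<Sum>j\<in>B. induced_A I v e $$ (i, j) * g (e j))"
    using B induced_A_index[OF en i] by (intro sum.cong) auto
  finally show ?thesis .
qed

text \<open>Without loops, all columns of the basis would be orthogonal to the vector that is \<open>1\<close> on men
  and \<open>-1\<close> on women.\<close>

lemma feasible_basis_contains_loop:
  assumes inst: "marriage_instance I" and en: "enumeration I v e"
    and feas: "feasible_basis (induced_A I v e) (induced_b I) B"
  shows "\<exists>a\<in>agents I. {a} \<in> e ` B"
proof (rule ccontr)
  assume no: "\<not> ?thesis"
  let ?n = "card (agents I)" and ?N = "card (agents I) + card (valid_edges I)"
  let ?z = "\<lambda>a. if a \<in> men I then 1 else -1 :: real"
  have A: "induced_A I v e \<in> carrier_mat ?n ?N" by (simp add: induced_A_def Let_def)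
  have b: "induced_b I \<in> carrier_vec ?n" by (simp add: induced_b_def)
  have v: "bij_betw v {..<?n} (agents I)" using en by (simp add: enumeration_def Let_def)
  have fin: "finite (agents I)" and ne: "agents I \<noteq> {}" and dis: "men I \<inter> women I = {}"
    using inst by (auto simp: marriage_instance_def)
  note B = feasible_basis_subset[OF A b feas]
  have "(\<Sum>i<?n. induced_A I v e $$ (i, j) * ?z (v i)) = 0" if j: "j \<in> B" for j
  proof -
    have jN: "j < ?N" using j B by auto
    then have ej: "e j \<in> edges I"
      using bij_betw_enumeration[OF inst en] by (auto simp: bij_betw_def)
    obtain m w where mw: "m \<in> men I" "w \<in> women I" "e j = {m, w}"
      using no j by (cases rule: edge_cases[OF inst ej]) auto
    have "(\<Sum>i<?n. induced_A I v e $$ (i, j) * ?z (v i))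
        = (\<Sum>i<?n. of_bool (v i \<in> e j) * ?z (v i))"
      using induced_A_index[OF en _ jN] by (intro sum.cong) auto
    also have "\<dots> = (\<Sum>a\<in>agents I. of_bool (a \<in> e j) * ?z a)"
      by (rule sum.reindex_bij_betw[OF v])
    also have "\<dots> = (\<Sum>a\<in>{m, w}. ?z a)"
      using fin mw by (intro sum.mono_neutral_cong_right) (auto simp: agents_def)
    also have "\<dots> = 0" using mw dis by (subst sum.insert) auto
    finally show ?thesis .
  qed
  then have "?z (v i) = 0" if "i < ?n" for i
    using feasible_basis_left_kernel[OF A b feas, of "\<lambda>i. ?z (v i)"] that by blast
  moreover have "0 < ?n" using fin ne by (simp add: card_gt_0_iff)
  ultimately show False by (metis one_neq_zero neg_equal_0_iff_equal)
qed

text \<open>The row that dominates a column need not, a priori, belong to an endpoint of the edge.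
  Here \<open>covered\<close> provides a basis edge at that agent; if the agent were not on
  \<open>h\<close>, this edge would have an entry smaller than that of \<open>h\<close>, against
  domination.\<close>

lemma ordinal_basis_dominates:
  assumes inst: "marriage_instance I" and en: "enumeration I v e"
    and ord: "ordinal_matrix (card (agents I)) (card (valid_edges I)) C"
    and cons: "consistent I v e C" and basis: "ordinal_basis C B"
    and covered: "\<And>a. a \<in> agents I \<Longrightarrow> \<exists>f\<in>e ` B. a \<in> f"
    and h: "h \<in> edges I"
  shows "\<exists>a\<in>h. \<forall>f\<in>e ` B. a \<in> f \<longrightarrow> f = h \<or> prefers I a f h"
proof -
  let ?n = "card (agents I)" and ?N = "card (agents I) + card (valid_edges I)"
  have dim: "dim_row C = ?n" "dim_col C = ?N" using ord by (auto simp: ordinal_matrix_def)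
  have B: "B \<subseteq> {..<?N}" "finite B"
    using basis dim finite_subset[of B "{..<?N}"] by (auto simp: ordinal_basis_def)
  obtain k where k: "k < ?N" "h = e k"
    using bij_betw_enumeration[OF inst en] h by (auto simp: bij_betw_def)
  obtain i where i: "i < ?n" and Min: "Min ((\<lambda>j. C $$ (i, j)) ` B) \<ge> C $$ (i, k)"
    using basis k dim by (auto simp: ordinal_basis_def)
  have ge: "C $$ (i, j) \<ge> C $$ (i, k)" if "j \<in> B" for j
  proof -
    have "Min ((\<lambda>j. C $$ (i, j)) ` B) \<le> C $$ (i, j)" using B(2) that by simp
    then show ?thesis using Min by simp
  qed
  have inj: "inj_on (\<lambda>j. C $$ (i, j)) {..<?N}" using ord i by (simp add: ordinal_matrix_def)
  have own: "v i \<in> e j \<Longrightarrow> v i \<notin> e l \<Longrightarrow> C $$ (i, j) < C $$ (i, l)"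
    and pref: "v i \<in> e j \<Longrightarrow> v i \<in> e l \<Longrightarrow> C $$ (i, j) > C $$ (i, l) \<longleftrightarrow> prefers I (v i) (e j) (e l)"
    if "j < ?N" "l < ?N" for j l
    using cons i that by (auto simp: consistent_def Let_def)
  have "v i \<in> agents I"
    using en i by (auto simp: enumeration_def Let_def bij_betw_def)
  then obtain j where "j \<in> B" "v i \<in> e j" using covered by blast
  then have vk: "v i \<in> e k" using own[of j k] ge[of j] B(1) k(1) by force
  have "e j = h \<or> prefers I (v i) (e j) h" if j: "j \<in> B" "v i \<in> e j" for j
  proof (cases "j = k")
    case False
    \<comment> \<open>Distinctness of the entries in a row makes the weak inequality strict, which
      consistency reads as strict preference.\<close>
    then have "C $$ (i, j) \<noteq> C $$ (i, k)" using inj j(1) B(1) k(1) by (auto dest: inj_onD)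
    then have "C $$ (i, j) > C $$ (i, k)" using ge[OF j(1)] by simp
    then show ?thesis using pref[of j k] j B(1) k vk by auto
  qed (simp add: k)
  then show ?thesis using vk k(2) by blast
qed

section \<open>Transfer of stability and optimality to the dominating vertex\<close>

theorem theorem5:
  fixes I :: "'a marriage"
    and v :: "nat \<Rightarrow> 'a" and e :: "nat \<Rightarrow> 'a set"
    and C :: "int mat" and x :: "real vec"
  assumes "marriage_instance I"
    and "card (men I) = card (women I)"
    and "\<forall>m \<in> men I. \<forall>w \<in> women I. {m, w} \<in> valid_edges I"
    and "enumeration I v e"
    and "ordinal_matrix (card (agents I)) (card (valid_edges I)) C"
    and "consistent I v e C"
    and "dominating_vertex (induced_A I v e) (induced_b I) C x"
  shows "\<exists>\<mu>. stable_matching I \<mu> \<and> (\<exists>a \<in> agents I. optimal_for I a \<mu>) \<and>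
             x = characteristic_vec I e \<mu>"
proof -
  let ?n = "card (agents I)" and ?N = "card (agents I) + card (valid_edges I)"
  let ?A = "induced_A I v e" and ?b = "induced_b I"
  note inst = assms(1) and en = assms(4)
  obtain B where feas: "feasible_basis ?A ?b B" and ordB: "ordinal_basis C B"
    and x: "x = basic_solution ?A ?b B"
    using assms(7) by (auto simp: dominating_vertex_def)
  have A: "?A \<in> carrier_mat ?n ?N" by (simp add: induced_A_def Let_def)
  have b: "?b \<in> carrier_vec ?n" by (simp add: induced_b_def)
  note B = feasible_basis_subset[OF A b feas]
  note sol = basic_solution_feasible[OF A b feas, folded x]
  have e: "bij_betw e {..<?N} (edges I)" by (rule bij_betw_enumeration[OF inst en])
  have v: "bij_betw v {..<?n} (agents I)" using en by (simp add: enumeration_def Let_def)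
  \<comment> \<open>The coordinates of \<open>x\<close> become values of edges through the inverse
    of the enumeration.\<close>
  define X where "X f = x $ inv_into {..<?N} e f" for f
  have X: "X (e j) = x $ j" if "j < ?N" for j
    using that e by (simp add: X_def bij_betw_def inv_into_f_f)
  have sum_x: "(\<Sum>f\<in>{f \<in> e ` B. a \<in> f}. X f) = 1" if "a \<in> agents I" for a
  proof -
    obtain i where i: "i < ?n" "a = v i" using v \<open>a \<in> agents I\<close> by (auto simp: bij_betw_def)
    have "(\<Sum>f\<in>{f \<in> e ` B. a \<in> f}. X f) = (\<Sum>j\<in>B. ?A $$ (i, j) * X (e j))"
      unfolding i(2) by (rule sum_edges_at[OF inst en B(1) i(1)])
    also have "\<dots> = (\<Sum>j\<in>B. ?A $$ (i, j) * x $ j)"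
      using B(1) X by (intro sum.cong) auto
    also have "\<dots> = 1" using sol(4)[OF i(1)] i(1) by (simp add: induced_b_def)
    finally show ?thesis .
  qed
  interpret dominating_solution I "e ` B" X
  proof
    show "marriage_instance I" by (fact inst)
    show "e ` B \<subseteq> edges I" using e B(1) by (auto simp: bij_betw_def)
    show "X f \<ge> 0" if f: "f \<in> e ` B" for f
    proof -
      obtain j where "j \<in> B" "f = e j" using f by blast
      then show ?thesis using X[of j] B(1) sol(2)[of j] by auto
    qed
    show "(\<Sum>f\<in>{f \<in> e ` B. a \<in> f}. X f) = 1" if "a \<in> agents I" for a
      using sum_x[OF that] .
    show "g f = 0" if zero: "\<And>a. a \<in> agents I \<Longrightarrow> (\<Sum>f\<in>{f \<in> e ` B. a \<in> f}. g f) = (0 :: real)"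
      and f: "f \<in> e ` B" for g f
    proof -
      have "(\<Sum>j\<in>B. ?A $$ (i, j) * g (e j)) = 0" if "i < ?n" for i
        using sum_edges_at[OF inst en B(1) that, of g] zero[of "v i"] v that
        by (auto simp: bij_betw_def)
      moreover obtain j where "j \<in> B" "f = e j" using f by blast
      ultimately show ?thesis
        using feasible_basis_kernel[OF A b feas, where g = "\<lambda>j. g (e j)"] by blast
    qed
    show "\<exists>a\<in>h. \<forall>f\<in>e ` B. a \<in> f \<longrightarrow> f = h \<or> prefers I a f h" if "h \<in> edges I" for h
    proof (rule ordinal_basis_dominates[OF inst en assms(5,6) ordB _ that])
      fix a assume "a \<in> agents I"
      \<comment> \<open>Feasibility supplies the covering condition: without a basis edge at
        \<open>a\<close>, the sum of values there would be 0 instead of 1.\<close>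
      then have "{f \<in> e ` B. a \<in> f} \<noteq> {}" using sum_x by (metis sum.empty zero_neq_one)
      then show "\<exists>f\<in>e ` B. a \<in> f" by blast
    qed
  qed
  obtain a where a: "a \<in> agents I" "{a} \<in> e ` B"
    using feasible_basis_contains_loop[OF inst en feas] by blast
  \<comment> \<open>The basis loop may belong to a man or to a woman, so both orientations are
    needed.\<close>
  have "complete_market I (men I) (women I)" "complete_market I (women I) (men I)"
    using assms(1-3) by (auto simp: complete_market_def)
  then have opt: "\<exists>a\<in>agents I. optimal_for I a support"
    using a optimal_support by (auto simp: agents_def)
  have "x = characteristic_vec I e support"
  proof (rule eq_vecI)
    show "dim_vec x = dim_vec (characteristic_vec I e support)"
      using sol(1) by (simp add: characteristic_vec_def)
    fix j assume "j < dim_vec (characteristic_vec I e support)"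
    then have j: "j < ?N" by (simp add: characteristic_vec_def)
    \<comment> \<open>Injectivity of \<open>e\<close> keeps nonbasic columns out of the support,
      where \<open>x\<close> has its default value 0.\<close>
    have "e j \<in> e ` B \<longleftrightarrow> j \<in> B"
      using e B(1) j by (auto simp: bij_betw_def dest: inj_onD)
    then have "x $ j = of_bool (e j \<in> support)"
      using value_cases[of "e j"] X[OF j] sol(3)[OF j] by (auto simp: support_def)
    then show "x $ j = characteristic_vec I e support $ j"
      using j by (simp add: characteristic_vec_def)
  qed
  then show ?thesis using stable_support opt by blast
qed

end
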